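(* Let $L$ be the free modular lattice $FM(3)$ on three generators and let $\mathbb{K} = (\mathcal{J}(L), \mathcal{M}(L), \leq)$ be its standard context. Then $L$ does not have a (two-dimensional) line diagram that is both realizer-embedded and additive, i.e., $$\mathrm{reLD}(L) \cap \mathrm{AddLD}(\mathbb{K}) = \emptyset .$$
   Context: **Lattices and contexts.** $FM(3)$ is the modular lattice freely generated by three elements (finite; no additional bounds are adjoined). For a finite lattice $L$, $\mathcal{J}(L)$ is the set of join-irreducible elements ($c > \bigvee\{\tilde c \mid \tilde c < c\}$) and $\mathcal{M}(L)$ is the set of meet-irreducible elements ($c < \bigwedge\{\tilde c \mid \tilde c > c\}$). The standard context is $\mathbb{K} = (G,M,I) = (\mathcal{J}(L), \mathcal{M}(L), \leq)$, where $G$ and $M$ are treated as disjoint sets (an element that is both join- and meet-irreducible occurs once in each). The concept lattice $\underline{\mathfrak{B}}(\mathbb{K})$ is isomorphic to $L$, where $x \in L$ corresponds to the formal concept $(A_x, B_x)$ with extent $A_x = \{j \in \mathcal{J}(L) \mid j \leq x\}$ and intent $B_x = \{m \in \mathcal{M}(L) \mid x \leq m\}$. We identify $L$ with $\underline{\mathfrak{B}}(\mathbb{K})$ in this way. **Line diagrams.** Write $u \prec v$ if $v$ covers $u$ in $L$. The set of line diagrams of $L$ is $$\mathrm{LD}(L) = \{\mathrm{pos} \colon L \to \mathbb{R}^2 \mid \forall u,v \in L \colon u \prec v \Rightarrow \mathrm{pos}(u)_y < \mathrm{pos}(v)_y\},$$ and $\mathrm{LD}(\mathbb{K}) := \mathrm{LD}(\underline{\mathfrak{B}}(\mathbb{K}))$.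 **Additive diagrams.** "Additive" means doubly-additive: $\mathrm{Add}(\mathbb{K})$ is the set of all maps $\mathrm{pos} \colon \underline{\mathfrak{B}}(\mathbb{K}) \to \mathbb{R}^2$ for which there is a map $\mathrm{vec} \colon G \,\dot\cup\, M \to \mathbb{R}^2$ such that for every formal concept $(A,B)$ $$\mathrm{pos}(A,B) = \sum_{s \in A \cup (M \setminus B)} \mathrm{vec}(s).$$ $\mathrm{AddLD}(\mathbb{K}) := \mathrm{Add}(\mathbb{K}) \cap \mathrm{LD}(\mathbb{K})$. **Realizer-embedded diagrams.** A linear extension of a finite ordered set $(P,\leq)$ is a strict total order $<_i$ on $P$ such that $p < q$ implies $p <_i q$. A set of linear extensions is a realizer if their intersection equals $<$. The order dimension of $P$ is the minimal cardinality of a realizer. For a linear extension $<_i$, let $\mathrm{pos}(c)_{<_i}$ denote the position of $c$ in $<_i$, counted from $0$, i.e. the number of elements $p$ with $p <_i c$ (so the positions range over $0, \dots, |P|-1$). Let $\mathrm{INC}(L)$ be the set of all pairs of incomparable elements of $L$. Let $T \subseteq \mathrm{INC}(L)$ be a set of minimal cardinality such that $\leq \cup\, T$ is an order relation on $L$ and the ordered set $(L, \leq \cup\, T)$ has a realizer $\{<_1, <_2\}$ consisting of two linear extensions ($T = \emptyset$ if $L$ itself has order dimension at most 2). A line diagram is realizer-embedded if it is obtained from some such minimal $T$ and some such realizer $\{<_1,<_2\}$ of $(L, \leq \cup\, T)$ by $\mathrm{pos}(c) := (\mathrm{pos}(c)_{<_1}, \mathrm{pos}(c)_{<_2})$ for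 all $c \in L$. The set of all realizer-embedded line diagrams of $L$ is $\mathrm{reLD}(L) \subseteq \mathrm{LD}(L)$. (For display, a fixed invertible linear transformation of the plane, $(0,1)\mapsto(-1,1)$, $(1,0)\mapsto(1,1)$ followed by axis scalings, may be applied; this does not change whether a diagram is additive.) *)

theory Defs
  imports Complex_Main "HOL-Library.Product_Plus"
begin

section \<open>Free modular lattices\<close>

class modular_lattice = lattice +
  assumes modular: "x \<le> z \<Longrightarrow> sup x (inf y z) = inf (sup x y) z"

datatype 'v lterm = LVar 'v | LJoin "'v lterm" "'v lterm" | LMeet "'v lterm" "'v lterm"

text \<open>Provable equality of terms in the equational theory of modular lattices. The last rule is
  the modular law as an identity: \<open>x \<sqinter> z\<close> is the generic element below \<open>z\<close>.\<close>

inductive modeq :: "'v lterm \<Rightarrow> 'v lterm \<Rightarrow> bool" where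
  modeq_refl: "modeq s s"
| modeq_sym: "modeq s t \<Longrightarrow> modeq t s"
| modeq_trans: "modeq s t \<Longrightarrow> modeq t u \<Longrightarrow> modeq s u"
| modeq_join_cong: "modeq s s' \<Longrightarrow> modeq t t' \<Longrightarrow> modeq (LJoin s t) (LJoin s' t')"
| modeq_meet_cong: "modeq s s' \<Longrightarrow> modeq t t' \<Longrightarrow> modeq (LMeet s t) (LMeet s' t')"
| modeq_join_comm: "modeq (LJoin s t) (LJoin t s)"
| modeq_meet_comm: "modeq (LMeet s t) (LMeet t s)"
| modeq_join_assoc: "modeq (LJoin (LJoin s t) u) (LJoin s (LJoin t u))"
| modeq_meet_assoc: "modeq (LMeet (LMeet s t) u) (LMeet s (LMeet t u))"
| modeq_join_absorb: "modeq (LJoin s (LMeet s t)) s"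
| modeq_meet_absorb: "modeq (LMeet s (LJoin s t)) s"
| modeq_modular: "modeq (LJoin (LMeet x z) (LMeet y z)) (LMeet (LJoin (LMeet x z) y) z)"

quotient_type 'v free_modular = "'v lterm" / modeq
  by (rule equivpI)
     (auto simp: reflp_def symp_def transp_def intro: modeq_refl modeq_sym modeq_trans)

instantiation free_modular :: (type) modular_lattice
begin

lift_definition sup_free_modular :: "'a free_modular \<Rightarrow> 'a free_modular \<Rightarrow> 'a free_modular"
  is LJoin by (rule modeq_join_cong)

lift_definition inf_free_modular :: "'a free_modular \<Rightarrow> 'a free_modular \<Rightarrow> 'a free_modular"
  is LMeet by (rule modeq_meet_cong)

definition less_eq_free_modular :: "'a free_modular \<Rightarrow> 'a free_modular \<Rightarrow> bool"
  where "less_eq_free_modular x y \<longleftrightarrow> inf x y = x"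

definition less_free_modular :: "'a free_modular \<Rightarrow> 'a free_modular \<Rightarrow> bool"
  where "less_free_modular x y \<longleftrightarrow> x \<le> y \<and> x \<noteq> y"

instance
proof -
  have jc: "sup x y = sup y x" for x y :: "'a free_modular"
    by transfer (rule modeq_join_comm)
  have mc: "inf x y = inf y x" for x y :: "'a free_modular"
    by transfer (rule modeq_meet_comm)
  have ja: "sup (sup x y) z = sup x (sup y z)" for x y z :: "'a free_modular"
    by transfer (rule modeq_join_assoc)
  have ma: "inf (inf x y) z = inf x (inf y z)" for x y z :: "'a free_modular"
    by transfer (rule modeq_meet_assoc)
  have jb: "sup x (inf x y) = x" for x y :: "'a free_modular"
    by transfer (rule modeq_join_absorb)
  have mb: "inf x (sup x y) = x" for x y :: "'a free_modular"
    by transfer (rule modeq_meet_absorb)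
  have md: "sup (inf x z) (inf y z) = inf (sup (inf x z) y) z" for x y z :: "'a free_modular"
    by transfer (rule modeq_modular)
  have mi: "inf x x = x" for x :: "'a free_modular"
    by (metis jb mb)
  have le_sup: "x \<le> y \<longleftrightarrow> sup x y = y" for x y :: "'a free_modular"
    unfolding less_eq_free_modular_def by (metis jb mb jc mc)
  have ji: "sup x x = x" for x :: "'a free_modular"
    by (metis jb mb)
  show "OFCLASS('a free_modular, modular_lattice_class)"
  proof
    fix x y z :: "'a free_modular"
    show "x \<le> x" by (simp add: less_eq_free_modular_def mi)
    show "x \<le> z" if "x \<le> y" "y \<le> z"
      using that by (metis less_eq_free_modular_def ma)
    show eq: "x = y" if "x \<le> y" "y \<le> x"
      using that by (metis less_eq_free_modular_def mc)
    show "x < y \<longleftrightarrow> x \<le> y \<and> \<not> y \<le> x"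
      by (metis less_free_modular_def less_eq_free_modular_def mc mi)
    show "inf x y \<le> x" by (metis less_eq_free_modular_def ma mc mi)
    show "inf x y \<le> y" by (metis less_eq_free_modular_def ma mi)
    show "x \<le> inf y z" if "x \<le> y" "x \<le> z"
      using that by (metis less_eq_free_modular_def ma)
    show "x \<le> sup x y" by (simp add: less_eq_free_modular_def mb)
    show "y \<le> sup x y" by (metis less_eq_free_modular_def mb jc)
    show "sup y z \<le> x" if "y \<le> x" "z \<le> x"
      using that by (metis le_sup ja)
    show "sup x (inf y z) = inf (sup x y) z" if "x \<le> z"
      using that md[of x z y] by (simp add: less_eq_free_modular_def)
  qed
qed

end

lift_definition gen :: "'v \<Rightarrow> 'v free_modular" is LVar .

lemma free_modular_universal:
  fixes f :: "'v \<Rightarrow> 'a::modular_lattice"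
  shows "\<exists>!h :: 'v free_modular \<Rightarrow> 'a.
    (\<forall>x y. h (sup x y) = sup (h x) (h y)) \<and> (\<forall>x y. h (inf x y) = inf (h x) (h y)) \<and>
    (\<forall>v. h (gen v) = f v)"
proof -
  define ev where "ev = rec_lterm f (\<lambda>_ _. sup) (\<lambda>_ _. inf)"
  have ev [simp]: "ev (LVar v) = f v" "ev (LJoin s t) = sup (ev s) (ev t)"
    "ev (LMeet s t) = inf (ev s) (ev t)" for v s t by (simp_all add: ev_def)
  have sound: "ev s = ev t" if "modeq s t" for s t
    using that
  proof induction
    case (modeq_modular x z y)
    show ?case using modular[of "inf (ev x) (ev z)" "ev z" "ev y"] by simp
  qed (auto simp: ac_simps)
  define h where "h q = ev (rep_free_modular q)" for q
  have rep: "modeq (rep_free_modular (abs_free_modular s)) s" for s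
    by (rule Quotient3_rep_abs[OF Quotient3_free_modular]) (rule modeq_refl)
  have h_abs [simp]: "h (abs_free_modular s) = ev s" for s
    unfolding h_def by (rule sound[OF rep])
  have surj: "\<exists>s. q = abs_free_modular s" for q :: "'v free_modular"
    by (metis Quotient3_abs_rep[OF Quotient3_free_modular])
  have abs: "abs_free_modular (LVar v) = gen v"
    "abs_free_modular (LJoin s t) = sup (abs_free_modular s) (abs_free_modular t)"
    "abs_free_modular (LMeet s t) = inf (abs_free_modular s) (abs_free_modular t)" for v :: 'v and s t
    by (simp_all add: gen.abs_eq sup_free_modular.abs_eq inf_free_modular.abs_eq)
  show ?thesis
  proof (rule ex1I[of _ h])
    have "h (sup x y) = sup (h x) (h y)" "h (inf x y) = inf (h x) (h y)" for x y
      using surj[of x] surj[of y] by (auto simp flip: abs(2,3))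
    moreover have "h (gen v) = f v" for v
      by (simp flip: abs(1))
    ultimately show "(\<forall>x y. h (sup x y) = sup (h x) (h y)) \<and>
      (\<forall>x y. h (inf x y) = inf (h x) (h y)) \<and> (\<forall>v. h (gen v) = f v)" by blast
  next
    fix k :: "'v free_modular \<Rightarrow> 'a"
    assume k: "(\<forall>x y. k (sup x y) = sup (k x) (k y)) \<and>
      (\<forall>x y. k (inf x y) = inf (k x) (k y)) \<and> (\<forall>v. k (gen v) = f v)"
    have "k (abs_free_modular s) = ev s" for s
      by (induction s) (simp_all add: abs k)
    then show "k = h" using surj by (metis ext h_abs)
  qed
qed

datatype gen3 = G1 | G2 | G3

type_synonym FM3 = "gen3 free_modular"


section \<open>Formal contexts and standard contexts\<close>

definition formal_concepts :: "'g set \<Rightarrow> 'm set \<Rightarrow> ('g \<Rightarrow> 'm \<Rightarrow> bool) \<Rightarrow> ('g set \<times> 'm set) set" where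
  "formal_concepts G M I = {(A, B). A \<subseteq> G \<and> B \<subseteq> M \<and>
     {m \<in> M. \<forall>g\<in>A. I g m} = B \<and> {g \<in> G. \<forall>m\<in>B. I g m} = A}"

definition concept_le :: "'g set \<times> 'm set \<Rightarrow> 'g set \<times> 'm set \<Rightarrow> bool" where
  "concept_le c d \<longleftrightarrow> fst c \<subseteq> fst d"

definition is_lub :: "'a::order set \<Rightarrow> 'a \<Rightarrow> bool" where
  "is_lub S s \<longleftrightarrow> (\<forall>x\<in>S. x \<le> s) \<and> (\<forall>u. (\<forall>x\<in>S. x \<le> u) \<longrightarrow> s \<le> u)"

definition is_glb :: "'a::order set \<Rightarrow> 'a \<Rightarrow> bool" where
  "is_glb S s \<longleftrightarrow> (\<forall>x\<in>S. s \<le> x) \<and> (\<forall>u. (\<forall>x\<in>S. u \<le> x) \<longrightarrow> u \<le> s)"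

text \<open>The least upper bound of the empty set is the least element, so the least element is not
  join-irreducible; dually for the greatest element.\<close>

definition join_irreducibles :: "'a::lattice set" where
  "join_irreducibles = {c. \<exists>s. is_lub {d. d < c} s \<and> s < c}"

definition meet_irreducibles :: "'a::lattice set" where
  "meet_irreducibles = {c. \<exists>s. is_glb {d. c < d} s \<and> c < s}"

text \<open>The concept \<open>(A\<^sub>x, B\<^sub>x)\<close> of the standard context identified with the lattice element \<open>x\<close>.\<close>

definition concept_of :: "'a::lattice \<Rightarrow> 'a set \<times> 'a set" where
  "concept_of x = ({j \<in> join_irreducibles. j \<le> x}, {m \<in> meet_irreducibles. x \<le> m})"


section \<open>Line diagrams\<close>

definition covered_by :: "'p set \<Rightarrow> ('p \<Rightarrow> 'p \<Rightarrow> bool) \<Rightarrow> 'p \<Rightarrow> 'p \<Rightarrow> bool" where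
  "covered_by P le u v \<longleftrightarrow> u \<in> P \<and> v \<in> P \<and> le u v \<and> u \<noteq> v \<and>
     \<not> (\<exists>w\<in>P. le u w \<and> u \<noteq> w \<and> le w v \<and> w \<noteq> v)"

definition LD :: "'p set \<Rightarrow> ('p \<Rightarrow> 'p \<Rightarrow> bool) \<Rightarrow> ('p \<Rightarrow> real \<times> real) set" where
  "LD P le = {pos. \<forall>u v. covered_by P le u v \<longrightarrow> snd (pos u) < snd (pos v)}"

text \<open>The sum type implements the disjoint union of objects and attributes. Values of \<open>pos\<close> outside
  the set of concepts and of \<open>vec\<close> outside \<open>G <+> M\<close> are irrelevant. The definition is meant for
  finite contexts, where the sum is a genuine one; \<open>FM3\<close> is finite (28 elements).\<close>

definition Add :: "'g set \<Rightarrow> 'm set \<Rightarrow> ('g \<Rightarrow> 'm \<Rightarrow> bool) \<Rightarrow> ('g set \<times> 'm set \<Rightarrow> real \<times> real) set" where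
  "Add G M I = {pos. \<exists>vec :: 'g + 'm \<Rightarrow> real \<times> real.
     \<forall>(A, B) \<in> formal_concepts G M I. pos (A, B) = (\<Sum>s \<in> A <+> (M - B). vec s)}"

definition AddLD :: "'g set \<Rightarrow> 'm set \<Rightarrow> ('g \<Rightarrow> 'm \<Rightarrow> bool) \<Rightarrow> ('g set \<times> 'm set \<Rightarrow> real \<times> real) set" where
  "AddLD G M I = Add G M I \<inter> LD (formal_concepts G M I) concept_le"

text \<open>The additive line diagrams of the standard context of a lattice, read as maps on the lattice
  itself via the identification of \<open>x\<close> with \<open>concept_of x\<close>.\<close>

definition standard_AddLD :: "('a::lattice \<Rightarrow> real \<times> real) set" where
  "standard_AddLD = {pos \<circ> concept_of | pos. pos \<in> AddLD join_irreducibles meet_irreducibles (\<le>)}"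


section \<open>Realizer-embedded diagrams\<close>

definition linear_extension :: "'a rel \<Rightarrow> 'a rel \<Rightarrow> bool" where
  "linear_extension r l \<longleftrightarrow> strict_linear_order l \<and> r - Id \<subseteq> l"

definition realizer :: "'a rel \<Rightarrow> 'a rel set \<Rightarrow> bool" where
  "realizer r R \<longleftrightarrow> (\<forall>l\<in>R. linear_extension r l) \<and> \<Inter>R = r - Id"

definition le_rel :: "'a::order rel" where
  "le_rel = {(x, y). x \<le> y}"

definition INC :: "'a::order rel" where
  "INC = {(x, y). \<not> x \<le> y \<and> \<not> y \<le> x}"

definition two_dim_completion :: "'a::order rel \<Rightarrow> bool" where
  "two_dim_completion T \<longleftrightarrow> T \<subseteq> INC \<and> partial_order_on UNIV (le_rel \<union> T) \<and>
     (\<exists>l1 l2. realizer (le_rel \<union> T) {l1, l2})"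

definition position :: "'a rel \<Rightarrow> 'a \<Rightarrow> nat" where
  "position l c = card {p. (p, c) \<in> l}"

definition reLD :: "('a::lattice \<Rightarrow> real \<times> real) set" where
  "reLD = {\<lambda>c. (real (position l1 c), real (position l2 c)) | l1 l2 T.
     is_arg_min card two_dim_completion T \<and> realizer (le_rel \<union> T) {l1, l2}}"

end

theory Submission
  imports Defs "HOL-Library.Product_Order"
begin

text \<open>
  No linear extension of \<open>FM(3)\<close> has an additive position function, so the set \<open>T\<close> plays no role.
  \<open>FM(3)\<close> consists of a lower cube, an upper cube, a middle diamond \<open>M\<^sub>3\<close> joining them, and three
  wings around the generators. If positions are additive, the position vector of the 28 elements
  is determined by the edge lengths \<open>p\<^sub>i\<close> of the lower cube, \<open>r\<^sub>i\<close> of the upper cube, the heights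
  \<open>a\<^sub>i\<close> of the atoms of the diamond and its height \<open>d\<close>. These 28 values would have to be exactly
  \<open>0, \<dots>, 27\<close>. Looking at the smallest and the largest values, two of the \<open>p\<^sub>i\<close> are 1 and 2,
  and so are two of the \<open>r\<^sub>i\<close>; a small finite search excludes what remains.
\<close>

section \<open>The values of an additive position function\<close>

text \<open>The value at the bottom of the lower cube is normalised to 0; \<open>q\<close> is the
  value at the top of the diamond, which is the bottom of the upper cube. The length
  \<open>p1\<close> belongs to the meet of the second and third generator, and so on.\<close>

definition cubes :: "int \<Rightarrow> int \<Rightarrow> int \<Rightarrow> int \<Rightarrow> int \<Rightarrow> int \<Rightarrow> int \<Rightarrow> int list" where
  "cubes p1 p2 p3 d r1 r2 r3 = (let q = p1 + p2 + p3 + d in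
     [0, p1, p2, p3, p2 + p3, p1 + p3, p1 + p2, p1 + p2 + p3,
      q, q + r1, q + r2, q + r3, q + r2 + r3, q + r1 + r3, q + r1 + r2, q + r1 + r2 + r3])"

text \<open>Relative to the bottom \<open>s\<close> of the diamond, \<open>wing\<close> lists the values at
  \<open>x \<sqinter> (y \<squnion> z)\<close>, \<open>x\<close>, the atom \<open>(x \<sqinter> (y \<squnion> z)) \<squnion> (y \<sqinter> z)\<close> of the diamond, and \<open>x \<squnion> (y \<sqinter> z)\<close>.\<close>

definition wing :: "int \<Rightarrow> int \<Rightarrow> int \<Rightarrow> int \<Rightarrow> int list" where
  "wing s p a r = [s - p + a, s - p + a + r, s + a, s + a + r]"

definition additive_values ::
  "int \<Rightarrow> int \<Rightarrow> int \<Rightarrow> int \<Rightarrow> int \<Rightarrow> int \<Rightarrow> int \<Rightarrow> int \<Rightarrow> int \<Rightarrow> int \<Rightarrow> int list" where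
  "additive_values p1 p2 p3 a1 a2 a3 d r1 r2 r3 = (let s = p1 + p2 + p3 in
     cubes p1 p2 p3 d r1 r2 r3 @ wing s p1 a1 r1 @ wing s p2 a2 r2 @ wing s p3 a3 r3)"

section \<open>Exhaustive search for compatible wings\<close>

definition apart :: "int list \<Rightarrow> int list \<Rightarrow> bool" where
  "apart xs ys \<longleftrightarrow> list_all (\<lambda>x. \<not> List.member ys x) xs"

text \<open>Here \<open>k\<close> is the edge length \<open>p\<^sub>3\<close>, after \<open>p\<^sub>1 = 1\<close> and \<open>p\<^sub>2 = 2\<close>.
  The case distinctions are written with \<open>if\<close> because \<open>code_simp\<close> would evaluate both sides of
  an implication.\<close>

definition wings_clash :: "int \<Rightarrow> int \<Rightarrow> int \<Rightarrow> int \<Rightarrow> int \<Rightarrow> bool" where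
  "wings_clash k r1 r2 r3 d = (let s = 3 + k; c = cubes 1 2 k d r1 r2 r3; as = [1..d - 1] in
     if distinct c \<and> r1 \<noteq> 1 \<and> r2 \<noteq> 2 \<and> r3 \<noteq> k then
       let w1 = filter (apart c) (map (\<lambda>a. wing s 1 a r1) as);
           w2 = filter (apart c) (map (\<lambda>a. wing s 2 a r2) as);
           w3 = filter (apart c) (map (\<lambda>a. wing s k a r3) as)
       in list_all (\<lambda>u. list_all (\<lambda>v. if apart u v
            then list_all (\<lambda>w. if apart u w then \<not> apart v w else True) w3 else True) w2) w1
     else True)"

text \<open>The largest value 27 is \<open>1 + 2 + k + d + 1 + 2 + m\<close>, where \<open>m\<close>
  is the third upper edge length; this fixes \<open>d\<close>. Since \<open>k\<close> and
  \<open>m\<close> are at least 4 and \<open>d\<close> is at least 2, the ranges cover all cases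
  that arise.\<close>

lemma wings_clash_all:
  "list_all (\<lambda>k. list_all (\<lambda>m. list_all (\<lambda>(r1, r2, r3). wings_clash k r1 r2 r3 (21 - k - m))
     [(1, 2, m), (1, m, 2), (2, 1, m), (2, m, 1), (m, 1, 2), (m, 2, 1)]) [4..19 - k]) [4..15]"
  by code_simp

lemma wings_clash_contra:
  assumes "wings_clash k r1 r2 r3 d" "a1 \<in> {0<..<d}" "a2 \<in> {0<..<d}" "a3 \<in> {0<..<d}"
  shows "\<not> distinct (additive_values 1 2 k a1 a2 a3 d r1 r2 r3)"
proof
  assume dist: "distinct (additive_values 1 2 k a1 a2 a3 d r1 r2 r3)"
  let ?w1 = "wing (3 + k) 1 a1 r1" and ?w2 = "wing (3 + k) 2 a2 r2" and ?w3 = "wing (3 + k) k a3 r3"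
  let ?c = "cubes 1 2 k d r1 r2 r3"
  have d: "distinct (?c @ ?w1 @ ?w2 @ ?w3)"
    using dist by (simp add: additive_values_def Let_def add.commute)
  \<comment> \<open>For \<open>p = r\<close> the second and third entries of a wing would
    coincide.\<close>
  then have "r1 \<noteq> 1" "r2 \<noteq> 2" "r3 \<noteq> k"
    by (auto simp: wing_def)
  moreover have apart: "apart ?c ?w1" "apart ?c ?w2" "apart ?c ?w3" "apart ?w1 ?w2"
    "apart ?w1 ?w3" "apart ?w2 ?w3"
    using d by (auto simp: apart_def list_all_iff)
  moreover have as: "a1 \<in> set [1..d - 1]" "a2 \<in> set [1..d - 1]" "a3 \<in> set [1..d - 1]"
    using assms by auto
  ultimately have cond: "distinct ?c \<and> r1 \<noteq> 1 \<and> r2 \<noteq> 2 \<and> r3 \<noteq> k"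
    using d by (meson distinct_append)
  have "wing (3 + k) p a r \<in> set (filter (apart ?c) (map (\<lambda>a. wing (3 + k) p a r) [1..d - 1]))"
    if "apart ?c (wing (3 + k) p a r)" "a \<in> set [1..d - 1]" for p a r
    unfolding set_filter set_map using that by blast
  note mem = this[OF apart(1) as(1)] this[OF apart(2) as(2)] this[OF apart(3) as(3)]
  note clash = assms(1)[unfolded wings_clash_def Let_def if_P[OF cond] list_all_iff]
  note clash = bspec[OF bspec[OF clash mem(1)] mem(2), unfolded if_P[OF apart(4)]]
  show False
    using bspec[OF clash mem(3), unfolded if_P[OF apart(5)]] apart(6) by contradiction
qed

section \<open>Reduction to the finite search\<close>

text \<open>This transposition of generators and the one in \<open>additive_values_23\<close>
  generate all permutations, which allows the \<open>p\<close>s to be sorted.\<close>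

lemma additive_values_12:
  "set (additive_values p2 p1 p3 a2 a1 a3 d r2 r1 r3) = set (additive_values p1 p2 p3 a1 a2 a3 d
    r1 r2 r3)"
  by (rule set_eqI) (simp add: additive_values_def cubes_def wing_def Let_def ac_simps disj_ac)

lemma additive_values_23:
  "set (additive_values p1 p3 p2 a1 a3 a2 d r1 r3 r2) = set (additive_values p1 p2 p3 a1 a2 a3 d
    r1 r2 r3)"
  by (rule set_eqI) (simp add: additive_values_def cubes_def wing_def Let_def ac_simps disj_ac)

lemma additive_values_not_interval_ordered:
  assumes set: "set (additive_values p1 p2 p3 a1 a2 a3 d r1 r2 r3) = {0..27}"
    and p: "0 < p1" "p1 < p2" "p2 < p3" and r: "0 < r1" "0 < r2" "0 < r3"
    and a: "a1 \<in> {0<..<d}" "a2 \<in> {0<..<d}" "a3 \<in> {0<..<d}"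
  shows False
proof -
  \<comment> \<open>A list of 28 entries covering 28 numbers has no repetitions.\<close>
  have dist: "distinct (additive_values p1 p2 p3 a1 a2 a3 d r1 r2 r3)"
    by (rule card_distinct) (simp only: set, simp add: additive_values_def cubes_def wing_def
      Let_def)
  note v = additive_values_def cubes_def wing_def Let_def
  have mem: "n \<in> set (additive_values p1 p2 p3 a1 a2 a3 d r1 r2 r3)" if "0 \<le> n" "n \<le> 27" for n
    using that set by simp
  have a': "0 < a1" "0 < a2" "0 < a3" "a1 < d" "a2 < d" "a3 < d" using a by auto
  note pos = p r a'
  \<comment> \<open>All nonzero values other than \<open>p1\<close> exceed \<open>p1\<close>;
    likewise all values except 0, \<open>p1\<close> and \<open>p2\<close> exceed
    \<open>p2\<close>.\<close>
  have "p1 = 1"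
    using mem[of 1] pos unfolding v by (simp; elim disjE; linarith)
  moreover have "p2 = 2"
    using mem[of 2] pos \<open>p1 = 1\<close> unfolding v by (simp; elim disjE; linarith)
  ultimately have p12: "p1 = 1" "p2 = 2" by auto
  \<comment> \<open>The entries at positions 3 and 6 are \<open>p3\<close> and
    \<open>p1 + p2\<close>.\<close>
  have "p3 \<noteq> 3" using nth_eq_iff_index_eq[OF dist, of 3 6] p12 by (simp add: v)
  then have p3: "4 \<le> p3" using p p12 by simp
  have "p1 + p2 + p3 + d + r1 + r2 + r3 \<in> {0..27}"
    unfolding set[symmetric] by (simp add: v)
  then have top: "p1 + p2 + p3 + d + r1 + r2 + r3 = 27"
    using mem[of 27] pos unfolding v by (simp; elim disjE; linarith)
  have neq: "r1 \<noteq> r2" "r1 \<noteq> r3" "r2 \<noteq> r3" "r1 \<noteq> r2 + r3" "r2 \<noteq> r1 + r3" "r3 \<noteq> r1 + r2"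
    using nth_eq_iff_index_eq[OF dist, of 9 10] nth_eq_iff_index_eq[OF dist, of 9 11]
      nth_eq_iff_index_eq[OF dist, of 10 11] nth_eq_iff_index_eq[OF dist, of 9 12]
      nth_eq_iff_index_eq[OF dist, of 10 13] nth_eq_iff_index_eq[OF dist, of 11 14]
    by (simp_all add: v)
  \<comment> \<open>The argument for \<open>p1\<close>, read from the top: the largest value below
    27 belongs to a coatom of the upper cube and is 27 minus some \<open>r\<close>.\<close>
  have one: "r1 = 1 \<or> r2 = 1 \<or> r3 = 1"
  proof (rule ccontr)
    assume "\<not> ?thesis"
    then have "1 < r1" "1 < r2" "1 < r3" using r by auto
    then show False
      using mem[of 26] pos top unfolding v by (simp; elim disjE; linarith)
  qed
  have two: "r1 = 2 \<or> r2 = 2 \<or> r3 = 2"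
  proof (rule ccontr)
    assume "\<not> ?thesis"
    then have "r1 = 1 \<or> 2 < r1" "r2 = 1 \<or> 2 < r2" "r3 = 1 \<or> 2 < r3" using r by auto
    then consider "r1 = 1" "2 < r2" "2 < r3" | "r2 = 1" "2 < r1" "2 < r3" | "r3 = 1" "2 < r1"
      "2 < r2"
      using one neq by auto
    then show False
      using mem[of 25] pos top unfolding v by cases ((simp; elim disjE; linarith)+)
  qed
  \<comment> \<open>The upper edge length that remains besides 1 and 2.\<close>
  define m where "m = r1 + r2 + r3 - 3"
  have perm: "(r1, r2, r3) \<in> set [(1, 2, m), (1, m, 2), (2, 1, m), (2, m, 1), (m, 1, 2), (m, 2, 1)]"
    using one two neq unfolding m_def by (elim disjE) simp_all
  have m: "4 \<le> m"
    using one two neq r unfolding m_def by (elim disjE; simp)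
  have d: "d = 21 - p3 - m" "2 \<le> d" using top p12 a' by (auto simp: m_def)
  have "p3 \<in> set [4..15]" "m \<in> set [4..19 - p3]"
    using p3 m d unfolding set_upto atLeastAtMost_iff by simp_all
  note bspec[OF bspec[OF bspec[OF wings_clash_all[unfolded list_all_iff] this(1)] this(2)] perm]
  then have "wings_clash p3 r1 r2 r3 d"
    by (simp only: prod.case d(1))
  then show False
    using wings_clash_contra[OF _ a] dist p12 by blast
qed

text \<open>Distinctness of the values makes the three \<open>p\<close>s different, and permuting
  the generators sorts them.\<close>

lemma additive_values_not_interval:
  assumes "set (additive_values p1 p2 p3 a1 a2 a3 d r1 r2 r3) = {0..27}"
    and "0 < p1" "0 < p2" "0 < p3" "0 < r1" "0 < r2" "0 < r3"
    and "a1 \<in> {0<..<d}" "a2 \<in> {0<..<d}" "a3 \<in> {0<..<d}"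
  shows False
proof -
  have "distinct (additive_values p1 p2 p3 a1 a2 a3 d r1 r2 r3)"
    by (rule card_distinct)
      (simp only: assms, simp add: additive_values_def cubes_def wing_def Let_def)
  note nth_eq_iff_index_eq[OF this]
  from this[of 1 2] this[of 1 3] this[of 2 3] have "p1 \<noteq> p2" "p1 \<noteq> p3" "p2 \<noteq> p3"
    by (simp_all add: additive_values_def cubes_def wing_def Let_def)
  then consider "p1 < p2" "p2 < p3" | "p1 < p3" "p3 < p2" | "p2 < p1" "p1 < p3"
    | "p2 < p3" "p3 < p1" | "p3 < p1" "p1 < p2" | "p3 < p2" "p2 < p1"
    by linarith
  then show False
  proof cases
    case 1
    then show ?thesis using additive_values_not_interval_ordered[OF assms(1)] assms(2-) by blast
  next
    case 2
    have "set (additive_values p1 p3 p2 a1 a3 a2 d r1 r3 r2) = {0..27}"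
      using assms(1) by (metis additive_values_23)
    from additive_values_not_interval_ordered[OF this] 2 assms(2-) show ?thesis by blast
  next
    case 3
    have "set (additive_values p2 p1 p3 a2 a1 a3 d r2 r1 r3) = {0..27}"
      using assms(1) by (metis additive_values_12)
    from additive_values_not_interval_ordered[OF this] 3 assms(2-) show ?thesis by blast
  next
    case 4
    have "set (additive_values p2 p3 p1 a2 a3 a1 d r2 r3 r1) = {0..27}"
      using assms(1) additive_values_12[of p2 p1 p3 a2 a1 a3 d r2 r1 r3]
        additive_values_23[of p2 p3 p1 a2 a3 a1 d r2 r3 r1] by argo
    from additive_values_not_interval_ordered[OF this] 4 assms(2-) show ?thesis by blast
  next
    case 5
    have "set (additive_values p3 p1 p2 a3 a1 a2 d r3 r1 r2) = {0..27}"
      using assms(1) additive_values_12[of p3 p1 p2 a3 a1 a2 d r3 r1 r2]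
        additive_values_23[of p1 p3 p2 a1 a3 a2 d r1 r3 r2] by argo
    from additive_values_not_interval_ordered[OF this] 5 assms(2-) show ?thesis by blast
  next
    case 6
    have "set (additive_values p3 p2 p1 a3 a2 a1 d r3 r2 r1) = {0..27}"
      using assms(1) additive_values_12[of p3 p2 p1 a3 a2 a1 d r3 r2 r1]
        additive_values_23[of p2 p3 p1 a2 a3 a1 d r2 r3 r1]
        additive_values_12[of p2 p1 p3 a2 a1 a3 d r2 r1 r3] by argo
    from additive_values_not_interval_ordered[OF this] 6 assms(2-) show ?thesis by blast
  qed
qed

section \<open>Sublattices generated by three elements\<close>

text \<open>The order of the elements (lower cube, upper cube, three wings) is that of
  \<open>additive_values\<close>. Meet and join are arguments so that the dual lattice can be treated alike.\<close>

definition fm3_elems :: "('a \<Rightarrow> 'a \<Rightarrow> 'a) \<Rightarrow> ('a \<Rightarrow> 'a \<Rightarrow> 'a) \<Rightarrow> 'a \<Rightarrow> 'a \<Rightarrow> 'a \<Rightarrow> 'a list" where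
  "fm3_elems m j x y z =
    [m x (m y z), m y z, m x z, m x y,
     j (m x y) (m x z), j (m x y) (m y z), j (m x z) (m y z), j (m x y) (j (m x z) (m y z)),
     m (j x y) (m (j x z) (j y z)),
     m (j x y) (j x z), m (j x y) (j y z), m (j x z) (j y z),
     j y z, j x z, j x y, j x (j y z),
     m x (j y z), x, j (m x (j y z)) (m y z), j x (m y z),
     m y (j x z), y, j (m y (j x z)) (m x z), j y (m x z),
     m z (j x y), z, j (m z (j x y)) (m x y), j z (m x y)]"

context modular_lattice
begin

lemma fm3_elems_swap12: "set (fm3_elems inf sup y x z) = set (fm3_elems inf sup x y z)"
  by (rule set_eqI) (simp add: fm3_elems_def ac_simps disj_ac)

lemma fm3_elems_swap23: "set (fm3_elems inf sup x z y) = set (fm3_elems inf sup x y z)"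
  by (rule set_eqI) (simp add: fm3_elems_def ac_simps disj_ac)

text \<open>The two descriptions of an atom of the diamond are dual to each other. Up to
  associativity and commutativity, their equality is all that makes the list self-dual.\<close>

lemma sup_inf_inf: "sup (inf x (sup y z)) (inf y z) = inf (sup x (inf y z)) (sup y z)"
  using modular[of "inf y z" "sup y z" x] by (simp add: ac_simps le_infI1 le_supI1)

lemma fm3_elems_dual: "set (fm3_elems sup inf x y z) = set (fm3_elems inf sup x y z)"
  using sup_inf_inf[of x y z] sup_inf_inf[of y x z] sup_inf_inf[of z x y]
  by (intro set_eqI) (simp add: fm3_elems_def ac_simps disj_ac)

section \<open>Closure of the 28 elements under joins and meets\<close>

lemmas le_simps = le_infI1 le_infI2 le_supI1 le_supI2

text \<open>All but six listed elements lie above \<open>inf x y\<close>; for these six the join is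
  again a listed term, up to absorption.\<close>

lemma sup_inf_mem_fm3_elems:
  assumes "s \<in> set (fm3_elems inf sup x y z)"
  shows "sup s (inf x y) \<in> set (fm3_elems inf sup x y z)"
proof -
  have "inf x y \<le> s \<or> s \<in> {inf x (inf y z), inf x z, inf y z, sup (inf x z) (inf y z),
    inf z (sup x y), z}"
    using assms unfolding fm3_elems_def
    by simp (elim disjE; simp add: le_simps)
  moreover have "sup (inf x (inf y z)) (inf x y) = inf x y"
    by (rule sup_absorb2) (simp add: le_infI2)
  ultimately show ?thesis using assms
    by (auto simp: sup_absorb1) (simp_all add: fm3_elems_def ac_simps)
qed

lemma sup_sandwich:
  assumes "l \<le> s" "s \<le> u" "sup l t = u"
  shows "sup s t = u"
  using assms by (metis order.antisym le_sup_iff sup.absorb_iff2 sup.cobounded2 sup_mono order_refl)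

text \<open>Each pair in \<open>R\<close> is an interval on which joining with \<open>t\<close> is
  constant, with its upper end as value. This replaces a computation for each single
  \<open>s\<close>.\<close>

lemma sup_mem_by_bounds:
  assumes "s \<le> t \<or> t \<le> s \<or> (\<exists>(l, u) \<in> R. l \<le> s \<and> s \<le> u)"
    and "\<And>l u. (l, u) \<in> R \<Longrightarrow> u = sup l t \<and> u \<in> A" and "s \<in> A" "t \<in> A"
  shows "sup s t \<in> A"
proof -
  consider "s \<le> t" | "t \<le> s" | l u where "(l, u) \<in> R" "l \<le> s" "s \<le> u"
    using assms(1) by blast
  then show ?thesis
  proof cases
    case 3
    with assms(2)[of l u] show ?thesis using sup_sandwich by metis
  qed (simp_all add: sup_absorb1 sup_absorb2 assms)
qed

lemma sup_gen_inf: "sup x (inf y (sup x z)) = inf (sup x y) (sup x z)"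
  using modular[of x "sup x z" y] by simp

lemma sup_gen_mem_fm3_elems:
  assumes "s \<in> set (fm3_elems inf sup x y z)"
  shows "sup s x \<in> set (fm3_elems inf sup x y z)"
proof -
  \<comment> \<open>These intervals, together with the elements comparable to \<open>x\<close>,
    cover the whole list.\<close>
  let ?pairs = "{(inf y z, sup x (inf y z)), (inf y (sup x z), inf (sup x y) (sup x z)),
    (inf z (sup x y), inf (sup x y) (sup x z)), (y, sup x y), (z, sup x z), (sup y z,
      sup x (sup y z))}"
  have "s \<le> x \<or> x \<le> s \<or> (\<exists>(l, u) \<in> ?pairs. l \<le> s \<and> s \<le> u)"
    using assms unfolding fm3_elems_def by simp (elim disjE; simp add: le_simps)
  moreover have "u = sup l x \<and> u \<in> set (fm3_elems inf sup x y z)" if "(l, u) \<in> ?pairs" for l u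
    using that sup_gen_inf[of x y z] sup_gen_inf[of x z y] by (auto simp: fm3_elems_def ac_simps)
  ultimately show ?thesis
    by (rule sup_mem_by_bounds) (use assms in \<open>simp_all add: fm3_elems_def\<close>)
qed

lemma sup_gen_inf_sup_mem_fm3_elems:
  assumes "s \<in> set (fm3_elems inf sup x y z)"
  shows "sup s (inf x (sup y z)) \<in> set (fm3_elems inf sup x y z)"
proof -
  \<comment> \<open>The top of the diamond.\<close>
  let ?q = "inf (sup x y) (inf (sup x z) (sup y z))"
  let ?pairs = "{(inf y z, sup (inf x (sup y z)) (inf y z)), (inf y (sup x z), ?q),
    (inf z (sup x y), ?q), (y, inf (sup x y) (sup y z)), (z, inf (sup x z) (sup y z))}"
  have "s \<le> inf x (sup y z) \<or> inf x (sup y z) \<le> s \<or> (\<exists>(l, u) \<in> ?pairs. l \<le> s \<and> s \<le> u)"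
    using assms unfolding fm3_elems_def by simp (elim disjE; simp add: le_simps)
  moreover have "u = sup l (inf x (sup y z)) \<and> u \<in> set (fm3_elems inf sup x y z)" if "(l,
    u) \<in> ?pairs" for l u
  proof -
    \<comment> \<open>The modular law is used twice: once to pull out \<open>sup y z\<close>, once
      to evaluate the remaining join with \<open>x\<close>.\<close>
    have "sup (inf y (sup x z)) (inf x (sup y z)) = ?q"
      using modular[of "inf y (sup x z)" "sup y z" x] sup_gen_inf[of x y z]
      by (simp add: ac_simps le_simps)
    moreover have "sup (inf z (sup x y)) (inf x (sup y z)) = ?q"
      using modular[of "inf z (sup x y)" "sup y z" x] sup_gen_inf[of x z y]
      by (simp add: ac_simps le_simps)
    ultimately show ?thesis
      using that sup_gen_inf[of y x z] sup_gen_inf[of z x y] by (auto simp: fm3_elems_def ac_simps)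
  qed
  ultimately show ?thesis
    by (rule sup_mem_by_bounds) (use assms in \<open>simp_all add: fm3_elems_def\<close>)
qed

lemma sup_mem_fm3_elems:
  assumes s: "s \<in> set (fm3_elems inf sup x y z)" and t: "t \<in> set (fm3_elems inf sup x y z)"
  shows "sup s t \<in> set (fm3_elems inf sup x y z)"
proof -
  \<comment> \<open>All 28 elements are joins of the nine join-irreducible ones and the least one, so only joins
    with these ten have to be computed.\<close>
  define C where "C = {t. \<forall>s \<in> set (fm3_elems inf sup x y z). sup s t \<in> set (fm3_elems inf sup x y
    z)}"
  have sup: "sup a b \<in> C" if "a \<in> C" "b \<in> C" for a b
    using that by (simp add: C_def flip: sup_assoc)
  have "inf x y \<in> C" "inf x z \<in> C" "inf y z \<in> C"
    using sup_inf_mem_fm3_elems[of _ x y z] sup_inf_mem_fm3_elems[of _ x z y]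
      sup_inf_mem_fm3_elems[of _ y z x]
      fm3_elems_swap12[of x y z] fm3_elems_swap23[of x y z] fm3_elems_swap12[of x z y]
        fm3_elems_swap23[of y x z]
    by (auto simp: C_def)
  moreover have "x \<in> C" "y \<in> C" "z \<in> C"
    using sup_gen_mem_fm3_elems[of _ x y z] sup_gen_mem_fm3_elems[of _ y x z]
      sup_gen_mem_fm3_elems[of _ z x y]
      fm3_elems_swap12[of x y z] fm3_elems_swap23[of x y z] fm3_elems_swap12[of x z y]
    by (auto simp: C_def)
  moreover have "inf x (sup y z) \<in> C" "inf y (sup x z) \<in> C" "inf z (sup x y) \<in> C"
    using sup_gen_inf_sup_mem_fm3_elems[of _ x y z] sup_gen_inf_sup_mem_fm3_elems[of _ y x z]
      sup_gen_inf_sup_mem_fm3_elems[of _ z x y]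
      fm3_elems_swap12[of x y z] fm3_elems_swap23[of x y z] fm3_elems_swap12[of x z y]
    by (auto simp: C_def)
  moreover have "inf x (inf y z) \<in> C"
  proof -
    have "inf x (inf y z) \<le> s" if "s \<in> set (fm3_elems inf sup x y z)" for s
      using that unfolding fm3_elems_def by simp (elim disjE; simp add: le_simps)
    then show ?thesis by (simp add: C_def sup_absorb1)
  qed
  \<comment> \<open>The listed meets of joins are rewritten as joins of elements already known to be
    in \<open>C\<close>.\<close>
  moreover have
    "inf (sup x y) (sup x z) = sup x (inf y (sup x z))"
    "inf (sup x y) (sup y z) = sup y (inf x (sup y z))"
    "inf (sup x z) (sup y z) = sup z (inf x (sup y z))"
    using sup_gen_inf[of x y z] sup_gen_inf[of y x z] sup_gen_inf[of z x y] by (simp_all add: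
      ac_simps)
  moreover have "inf (sup x y) (inf (sup x z) (sup y z)) = sup (inf y (sup x z)) (inf x (sup y z))"
    using modular[of "inf y (sup x z)" "sup y z" x] sup_gen_inf[of x y z]
    by (simp add: ac_simps le_simps)
  ultimately have "set (fm3_elems inf sup x y z) \<subseteq> C"
    unfolding fm3_elems_def by (simp add: sup)
  then show ?thesis using s t by (auto simp: C_def)
qed

text \<open>The modular law is self-dual, and so is the list of elements; hence closure under joins
  yields closure under meets.\<close>

lemma dual_modular_lattice: "class.modular_lattice sup (\<lambda>x y. y \<le> x) (\<lambda>x y. y < x) inf"
  by (intro class.modular_lattice.intro dual_lattice)
    (unfold_locales, metis modular inf_commute sup_commute)

lemma inf_mem_fm3_elems:
  assumes "s \<in> set (fm3_elems inf sup x y z)" "t \<in> set (fm3_elems inf sup x y z)"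
  shows "inf s t \<in> set (fm3_elems inf sup x y z)"
  using modular_lattice.sup_mem_fm3_elems[OF dual_modular_lattice] assms by (simp add:
    fm3_elems_dual)

end

section \<open>The word problem for \<open>FM(3)\<close>\<close>

instance bool :: modular_lattice
  by standard auto

instance prod :: (modular_lattice, modular_lattice) modular_lattice
  by standard (auto simp: modular less_eq_prod_def)

datatype m3 = Bot3 | At3 gen3 | Top3

instantiation m3 :: modular_lattice
begin

definition "a \<le> b \<longleftrightarrow> a = Bot3 \<or> b = Top3 \<or> (a :: m3) = b"
definition "a < b \<longleftrightarrow> a \<le> b \<and> (a :: m3) \<noteq> b"
definition "sup a b = (if a \<le> b then b else if b \<le> a then a else Top3 :: m3)"
definition "inf a b = (if a \<le> b then a else if b \<le> a then b else Bot3 :: m3)"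

instance
  by standard (auto simp: less_eq_m3_def less_m3_def sup_m3_def inf_m3_def split: if_splits)

end

lemma m3_simps [simp]:
  "sup (At3 a) (At3 b) = (if a = b then At3 a else Top3)" "inf (At3 a) (At3 b) = (if a =
    b then At3 a else Bot3)"
  "sup Bot3 c = c" "sup c Bot3 = c" "inf Bot3 c = Bot3" "inf c Bot3 = Bot3"
  "sup Top3 c = Top3" "sup c Top3 = Top3" "inf Top3 c = c" "inf c Top3 = c"
  "Bot3 \<le> c" "c \<le> Top3" "At3 a \<le> At3 b \<longleftrightarrow> a = b" "\<not> At3 a \<le> Bot3" "\<not> Top3 \<le> At3 a" "\<not> Top3 \<le> Bot3"
  by (auto simp: sup_m3_def inf_m3_def less_eq_m3_def)

text \<open>\<open>FM(3)\<close> is a subdirect product of six two-element lattices and \<open>M\<^sub>3\<close>.\<close>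

type_synonym fm3_image = "bool \<times> bool \<times> bool \<times> bool \<times> bool \<times> bool \<times> m3"

text \<open>The first three coordinates single out one generator as true, the next three single out
  one as false, and the last sends the generators to the three atoms of the diamond.\<close>

definition gen_image :: "gen3 \<Rightarrow> fm3_image" where
  "gen_image g = (g = G1, g = G2, g = G3, g \<noteq> G1, g \<noteq> G2, g \<noteq> G3, At3 g)"

definition to_image :: "FM3 \<Rightarrow> fm3_image" where
  "to_image = (THE h. (\<forall>x y. h (sup x y) = sup (h x) (h y)) \<and>
    (\<forall>x y. h (inf x y) = inf (h x) (h y)) \<and> (\<forall>v. h (gen v) = gen_image v))"

lemma to_image_sup: "to_image (sup x y) = sup (to_image x) (to_image y)"
  and to_image_inf: "to_image (inf x y) = inf (to_image x) (to_image y)"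
  and to_image_gen: "to_image (gen v) = gen_image v"
  using theI'[OF free_modular_universal[of gen_image]] unfolding to_image_def by blast+

lemma free_modular_induct [case_names gen sup inf]:
  assumes "\<And>v. P (gen v)" "\<And>x y. P x \<Longrightarrow> P y \<Longrightarrow> P (sup x y)" "\<And>x y. P x \<Longrightarrow> P y \<Longrightarrow> P (inf x y)"
  shows "P q"
proof (induction q rule: free_modular.abs_induct)
  case (1 t)
  then show ?case
    by (induction t) (use assms in \<open>simp_all flip: gen.abs_eq sup_free_modular.abs_eq
      inf_free_modular.abs_eq\<close>)
qed

abbreviation fm3_list :: "FM3 list" where
  "fm3_list \<equiv> fm3_elems inf sup (gen G1) (gen G2) (gen G3)"

lemma UNIV_FM3: "UNIV = set fm3_list"
proof -
  have "q \<in> set fm3_list" for q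
  proof (induction q rule: free_modular_induct)
    case (gen v)
    then show ?case by (cases v) (simp_all add: fm3_elems_def)
  qed (simp_all add: sup_mem_fm3_elems inf_mem_fm3_elems)
  then show ?thesis by blast
qed

lemmas to_image_simps = to_image_sup to_image_inf to_image_gen gen_image_def

text \<open>As \<open>fm3_list\<close> exhausts \<open>FM3\<close>, distinct images make
  \<open>to_image\<close> injective. Equality and order in \<open>FM3\<close> are thus decided by
  computing with tuples.\<close>

lemma distinct_images: "distinct (map to_image fm3_list)"
  by (simp add: fm3_elems_def to_image_simps)

lemma inj_to_image: "inj to_image"
  using distinct_images unfolding UNIV_FM3 distinct_map by blast

lemma FM3_le_iff: "a \<le> b \<longleftrightarrow> to_image a \<le> to_image b"
  by (metis inf.absorb_iff1 inj_to_image injD to_image_inf)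

lemma card_FM3: "card (UNIV :: FM3 set) = 28"
  using distinct_images unfolding UNIV_FM3 distinct_map distinct_card by (simp add: fm3_elems_def)

section \<open>Standard contexts and positions in finite lattices\<close>

text \<open>A minimal \<open>y\<close> below \<open>x\<close> but not below \<open>m\<close> is
  join-irreducible: everything strictly below \<open>y\<close> is below \<open>m\<close>, hence so
  is the join of these elements.\<close>

lemma join_irreducibles_dense:
  fixes x m :: "'a::lattice"
  assumes "finite (UNIV :: 'a set)" and le: "\<And>j. j \<in> join_irreducibles \<Longrightarrow> j \<le> x \<Longrightarrow> j \<le> m"
  shows "x \<le> m"
proof (rule ccontr)
  assume "\<not> x \<le> m"
  then obtain y where y: "y \<le> x" "\<not> y \<le> m" and min: "\<And>z. z \<le> x \<Longrightarrow> \<not> z \<le> m \<Longrightarrow> z \<le> y \<Longrightarrow> z = y"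
    using finite_has_minimal[of "{y. y \<le> x \<and> \<not> y \<le> m}"] finite_subset[OF subset_UNIV assms(1)]
    by blast
  let ?D = "{d. d < y}" and ?s = "Sup_fin {d. d < y}"
  have fin: "finite ?D" by (rule finite_subset[OF subset_UNIV assms(1)])
  \<comment> \<open>This witness is needed because \<open>Sup_fin\<close> is meaningful only for
    nonempty sets.\<close>
  have "inf y m \<in> ?D" using y(2) by (simp add: less_le) (metis inf_le2)
  then have ne: "?D \<noteq> {}" by blast
  have "d \<le> m" if "d \<in> ?D" for d
    using min[of d] that y(1) by (auto dest: less_imp_le order_trans)
  then have "?s \<le> m" using fin ne by (simp add: Sup_fin.bounded_iff)
  moreover have "?s \<le> y" using fin ne by (simp add: Sup_fin.bounded_iff less_imp_le)
  moreover have "is_lub ?D ?s"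
    using fin ne by (simp add: is_lub_def Sup_fin.bounded_iff Sup_fin.coboundedI)
  ultimately have "y \<in> join_irreducibles"
    using y(2) unfolding join_irreducibles_def by (metis (mono_tags,
      lifting) less_le mem_Collect_eq)
  then show False using le y by blast
qed

lemma meet_irreducibles_dense:
  fixes x j :: "'a::lattice"
  assumes "finite (UNIV :: 'a set)" and le: "\<And>m. m \<in> meet_irreducibles \<Longrightarrow> x \<le> m \<Longrightarrow> j \<le> m"
  shows "j \<le> x"
proof (rule ccontr)
  assume "\<not> j \<le> x"
  then obtain y where y: "x \<le> y" "\<not> j \<le> y" and max: "\<And>z. x \<le> z \<Longrightarrow> \<not> j \<le> z \<Longrightarrow> y \<le> z \<Longrightarrow> z = y"
    using finite_has_maximal[of "{y. x \<le> y \<and> \<not> j \<le> y}"] finite_subset[OF subset_UNIV assms(1)]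
    by blast
  let ?D = "{d. y < d}" and ?s = "Inf_fin {d. y < d}"
  have fin: "finite ?D" by (rule finite_subset[OF subset_UNIV assms(1)])
  have "sup y j \<in> ?D" using y(2) by (simp add: less_le) (metis sup_ge2)
  then have ne: "?D \<noteq> {}" by blast
  have "j \<le> d" if "d \<in> ?D" for d
    using max[of d] that y(1) by (auto dest: less_imp_le order_trans)
  then have "j \<le> ?s" using fin ne by (simp add: Inf_fin.bounded_iff)
  moreover have "y \<le> ?s" using fin ne by (simp add: Inf_fin.bounded_iff less_imp_le)
  moreover have "is_glb ?D ?s"
    using fin ne by (simp add: is_glb_def Inf_fin.bounded_iff Inf_fin.coboundedI)
  ultimately have "y \<in> meet_irreducibles"
    using y(2) unfolding meet_irreducibles_def by (metis (mono_tags,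
      lifting) less_le mem_Collect_eq)
  then show False using le y by blast
qed

text \<open>Density of the irreducibles makes extent and intent determine each other through
  \<open>x\<close>.\<close>

lemma concept_of_formal_concept:
  assumes "finite (UNIV :: 'a::lattice set)"
  shows "concept_of (x :: 'a) \<in> formal_concepts join_irreducibles meet_irreducibles (\<le>)"
proof -
  have up: "(\<forall>j \<in> {j \<in> join_irreducibles. j \<le> x}. j \<le> m) \<longleftrightarrow> x \<le> m" for m
    using join_irreducibles_dense[OF assms, of x m] order_trans[of _ x m] by blast
  have down: "(\<forall>m \<in> {m \<in> meet_irreducibles. x \<le> m}. j \<le> m) \<longleftrightarrow> j \<le> x" for j
    using meet_irreducibles_dense[OF assms, of x j] order_trans[of j x] by blast
  show ?thesis
    unfolding concept_of_def formal_concepts_def by (simp only: mem_Collect_eq prod.case up down)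
      blast
qed

lemma sup_not_join_irreducible:
  assumes "a \<noteq> sup a b" "b \<noteq> sup a b"
  shows "sup a b \<notin> join_irreducibles"
proof
  assume "sup a b \<in> join_irreducibles"
  then obtain s where s: "is_lub {d. d < sup a b} s" "s < sup a b"
    unfolding join_irreducibles_def by blast
  have "a < sup a b" "b < sup a b" using assms by (simp_all add: less_le)
  then have "sup a b \<le> s" using s(1) unfolding is_lub_def by simp
  then show False using s(2) by (simp add: less_le_not_le)
qed

lemma inf_not_meet_irreducible:
  assumes "a \<noteq> inf a b" "b \<noteq> inf a b"
  shows "inf a b \<notin> meet_irreducibles"
proof
  assume "inf a b \<in> meet_irreducibles"
  then obtain s where s: "is_glb {d. inf a b < d} s" "inf a b < s"
    unfolding meet_irreducibles_def by blast
  have "inf a b < a" "inf a b < b" using assms by (simp_all add: less_le)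
  then have "s \<le> inf a b" using s(1) unfolding is_glb_def by simp
  then show False using s(2) by (simp add: less_le_not_le)
qed

text \<open>The coefficients are extended by 0 outside the irreducibles, so upper bounds
  \<open>J\<close> and \<open>M\<close> for the sets of irreducibles suffice.\<close>

lemma standard_AddLD_fst:
  fixes f :: "'a::lattice \<Rightarrow> real \<times> real"
  assumes f: "f \<in> standard_AddLD" and fin: "finite (UNIV :: 'a set)"
    and J: "join_irreducibles \<subseteq> J" and M: "meet_irreducibles \<subseteq> M"
  obtains v w where "\<And>x. fst (f x) = (\<Sum>j\<in>J. if j \<le> x then v j else 0) +
    (\<Sum>m\<in>M. if x \<le> m then 0 else w m)"
proof -
  note fin' [simp] = finite_subset[OF subset_UNIV fin]
  obtain pos vec where f_eq: "f = pos \<circ> concept_of"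
    and vec: "\<forall>(A, B) \<in> formal_concepts join_irreducibles meet_irreducibles ((\<le>) :: 'a \<Rightarrow> 'a \<Rightarrow> bool).
      pos (A, B) = (\<Sum>s \<in> A <+> (meet_irreducibles - B). vec s)"
    using f unfolding standard_AddLD_def AddLD_def Add_def by blast
  define v where "v j = (if j \<in> join_irreducibles then fst (vec (Inl j)) else 0)" for j
  define w where "w m = (if m \<in> meet_irreducibles then fst (vec (Inr m)) else 0)" for m
  have "fst (f x) = (\<Sum>j\<in>J. if j \<le> x then v j else 0) + (\<Sum>m\<in>M. if x \<le> m then 0 else w m)" for x
  proof -
    have "f x = (\<Sum>s \<in> {j \<in> join_irreducibles. j \<le> x} <+> (meet_irreducibles - {m \<in>
      meet_irreducibles. x \<le> m}). vec s)"
      using vec concept_of_formal_concept[OF fin, of x] unfolding f_eq by (auto simp: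
        concept_of_def)
    then have "fst (f x) = (\<Sum>j | j \<in> join_irreducibles \<and> j \<le> x. fst (vec (Inl j)))
        + (\<Sum>m \<in> meet_irreducibles - {m \<in> meet_irreducibles. x \<le> m}. fst (vec (Inr m)))"
      by (simp add: sum.Plus fst_sum)
    moreover have "(\<Sum>j | j \<in> join_irreducibles \<and> j \<le> x. fst (vec (Inl j))) =
      (\<Sum>j\<in>J. if j \<le> x then v j else 0)"
      by (rule sum.mono_neutral_cong_left) (use J in \<open>auto simp: v_def\<close>)
    moreover have "(\<Sum>m \<in> meet_irreducibles - {m \<in> meet_irreducibles. x \<le> m}. fst (vec (Inr m)))
        = (\<Sum>m\<in>M. if x \<le> m then 0 else w m)"
      by (rule sum.mono_neutral_cong_left) (use M in \<open>auto simp: w_def\<close>)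
    ultimately show ?thesis by simp
  qed
  then show thesis by (rule that)
qed

section \<open>Positions in a finite strict linear order\<close>

lemma position_less:
  assumes "finite (UNIV :: 'a set)" "strict_linear_order l" "(a :: 'a, b) \<in> l"
  shows "position l a < position l b"
proof -
  have "trans l" "irrefl l" using assms(2) by (auto simp: strict_linear_order_on_def)
  then have "{p. (p, a) \<in> l} \<subset> {p. (p, b) \<in> l}"
    using assms(3) by (auto dest: transD simp: irrefl_def)
  then show ?thesis
    unfolding position_def by (rule psubset_card_mono[OF finite_subset[OF subset_UNIV assms(1)]])
qed

text \<open>Positions are injective and smaller than the number of elements, so they fill the
  interval.\<close>

lemma range_position:
  assumes fin: "finite (UNIV :: 'a set)" and l: "strict_linear_order (l :: 'a rel)"
  shows "range (position l) = {..<card (UNIV :: 'a set)}"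
proof (rule card_subset_eq)
  have "inj (position l)"
  proof (rule injI)
    fix a b assume eq: "position l a = position l b"
    then have "(a, b) \<notin> l" "(b, a) \<notin> l"
      using position_less[OF fin l] by fastforce+
    then show "a = b"
      using l by (auto simp: strict_linear_order_on_def total_on_def)
  qed
  then show "card (range (position l)) = card {..<card (UNIV :: 'a set)}"
    by (simp add: card_image)
  have "{p. (p, c) \<in> l} \<subset> UNIV" for c
    using l by (auto simp: strict_linear_order_on_def irrefl_def)
  then show "range (position l) \<subseteq> {..<card (UNIV :: 'a set)}"
    unfolding position_def using psubset_card_mono[OF fin] by blast
qed simp

section \<open>The irreducible elements of \<open>FM(3)\<close>\<close>

definition images :: "fm3_image list" where
  "images = fm3_elems inf sup (gen_image G1) (gen_image G2) (gen_image G3)"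

lemmas images_simps = images_def[simplified fm3_elems_def gen_image_def, simplified]

lemma images_nth:
  "images ! 0 = (False, False, False, False, False, False, Bot3)"
  "images ! (Suc 0) = (False, False, False, True, False, False, Bot3)"
  "images ! 2 = (False, False, False, False, True, False, Bot3)"
  "images ! 3 = (False, False, False, False, False, True, Bot3)"
  "images ! 4 = (False, False, False, False, True, True, Bot3)"
  "images ! 5 = (False, False, False, True, False, True, Bot3)"
  "images ! 6 = (False, False, False, True, True, False, Bot3)"
  "images ! 7 = (False, False, False, True, True, True, Bot3)"
  "images ! 8 = (False, False, False, True, True, True, Top3)"
  "images ! 9 = (True, False, False, True, True, True, Top3)"
  "images ! 10 = (False, True, False, True, True, True, Top3)"
  "images ! 11 = (False, False, True, True, True, True, Top3)"
  "images ! 12 = (False, True, True, True, True, True, Top3)"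
  "images ! 13 = (True, False, True, True, True, True, Top3)"
  "images ! 14 = (True, True, False, True, True, True, Top3)"
  "images ! 15 = (True, True, True, True, True, True, Top3)"
  "images ! 16 = (False, False, False, False, True, True, At3 G1)"
  "images ! 17 = (True, False, False, False, True, True, At3 G1)"
  "images ! 18 = (False, False, False, True, True, True, At3 G1)"
  "images ! 19 = (True, False, False, True, True, True, At3 G1)"
  "images ! 20 = (False, False, False, True, False, True, At3 G2)"
  "images ! 21 = (False, True, False, True, False, True, At3 G2)"
  "images ! 22 = (False, False, False, True, True, True, At3 G2)"
  "images ! 23 = (False, True, False, True, True, True, At3 G2)"
  "images ! 24 = (False, False, False, True, True, False, At3 G3)"
  "images ! 25 = (False, False, True, True, True, False, At3 G3)"
  "images ! 26 = (False, False, False, True, True, True, At3 G3)"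
  "images ! 27 = (False, False, True, True, True, True, At3 G3)"
  by (simp_all add: images_simps)

lemma to_image_nth: "i < 28 \<Longrightarrow> to_image (fm3_list ! i) = images ! i"
proof -
  have "map to_image fm3_list = images"
    by (simp add: images_def fm3_elems_def to_image_sup to_image_inf to_image_gen)
  moreover have "length fm3_list = 28" by (simp add: fm3_elems_def)
  ultimately show "i < 28 \<Longrightarrow> to_image (fm3_list ! i) = images ! i"
    by (metis nth_map)
qed

lemma fm3_nth_le_iff:
  "i < 28 \<Longrightarrow> k < 28 \<Longrightarrow> fm3_list ! i \<le> fm3_list ! k \<longleftrightarrow> images ! i \<le> images ! k"
  by (simp add: FM3_le_iff to_image_nth)

lemma length_fm3_list: "length fm3_list = 28"
  by (simp add: fm3_elems_def)

lemma distinct_fm3_list: "distinct fm3_list"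
  using distinct_images by (simp add: distinct_map)

lemma fm3_nth_sup:
  assumes "i < 28" "k < 28" "n < 28" "images ! n = sup (images ! i) (images ! k)"
  shows "fm3_list ! n = sup (fm3_list ! i) (fm3_list ! k)"
  by (rule injD[OF inj_to_image]) (simp add: assms to_image_sup to_image_nth)

lemma fm3_nth_inf:
  assumes "i < 28" "k < 28" "n < 28" "images ! n = inf (images ! i) (images ! k)"
  shows "fm3_list ! n = inf (fm3_list ! i) (fm3_list ! k)"
  by (rule injD[OF inj_to_image]) (simp add: assms to_image_inf to_image_nth)

lemma fm3_index:
  fixes q :: FM3
  obtains i where "i < 28" "q = fm3_list ! i"
  using UNIV_FM3 length_fm3_list by (metis UNIV_I in_set_conv_nth)

lemma all_less_28:
  "(\<forall>i < 28. P i) \<longleftrightarrow> P 27 \<and> P 26 \<and> P 25 \<and> P 24 \<and> P 23 \<and> P 22 \<and> P 21 \<and> P 20 \<and> P 19 \<and> P 18 \<and> P 17 \<and>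
    P 16 \<and> P 15 \<and> P 14
    \<and> P 13 \<and> P 12 \<and> P 11 \<and> P 10 \<and> P 9 \<and> P 8 \<and> P 7 \<and> P 6 \<and> P 5 \<and> P 4 \<and> P 3 \<and> P 2 \<and> P (Suc 0) \<and> P 0"
  by (simp add: numeral_eq_Suc All_less_Suc)

text \<open>The atoms of the lower cube, the bottoms of the wings, and the generators. Dually,
  \<open>M_idx\<close> lists the coatoms of the upper cube, the generators, and the tops of the
  wings.\<close>

definition J_idx :: "nat list" where "J_idx = [1, 2, 3, 16, 20, 24, 17, 21, 25]"
definition M_idx :: "nat list" where "M_idx = [12, 13, 14, 17, 19, 21, 23, 25, 27]"

text \<open>A triple \<open>(n, i, k)\<close> is a certificate that element \<open>n\<close> is the
  join of two elements different from it.\<close>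

lemma nth_not_join_irreducible:
  assumes "list_all (\<lambda>(n, i, k). n < 28 \<and> i < 28 \<and> k < 28 \<and> n \<noteq> i \<and> n \<noteq> k \<and> images ! n =
    sup (images ! i) (images ! k)) xs"
    and "n \<in> fst ` set xs"
  shows "fm3_list ! n \<notin> join_irreducibles"
proof -
  obtain i k where "(n, i, k) \<in> set xs" using assms(2) by fastforce
  then have *: "n < 28" "i < 28" "k < 28" "n \<noteq> i" "n \<noteq> k" "images ! n =
    sup (images ! i) (images ! k)"
    using assms(1) by (auto simp: list_all_iff)
  have "fm3_list ! i \<noteq> fm3_list ! n" "fm3_list ! k \<noteq> fm3_list ! n"
    using * nth_eq_iff_index_eq[OF distinct_fm3_list] length_fm3_list by auto
  then show ?thesis
    using sup_not_join_irreducible fm3_nth_sup * by metis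
qed

lemma join_irreducibles_FM3: "(join_irreducibles :: FM3 set) \<subseteq> (!) fm3_list ` set J_idx"
proof
  fix q :: FM3
  assume q: "q \<in> join_irreducibles"
  obtain n where n: "n < 28" "q = fm3_list ! n" by (rule fm3_index)
  let ?xs = "[(4,2,3),(5,1,3),(6,1,2),(7,1,4),(8,16,20),(9,17,20),(10,21,16),(11,25,16),(12,21,25),(13,17,25),
    (14,17,21),(15,17,12),(18,16,1),(19,17,1),(22,20,2),(23,21,2),(26,24,3),(27,25,3)] :: (nat \<times>
      nat \<times> nat) list"
  have "list_all (\<lambda>(n, i, k). n < 28 \<and> i < 28 \<and> k < 28 \<and> n \<noteq> i \<and> n \<noteq> k \<and> images ! n =
    sup (images ! i) (images ! k)) ?xs"
    by (simp add: images_nth)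
  note * = nth_not_join_irreducible[OF this]
  have "\<forall>n < 28. n \<in> set J_idx \<or> n = 0 \<or> n \<in> fst ` set ?xs"
    unfolding all_less_28 by (simp add: J_idx_def)
  \<comment> \<open>A join-irreducible element lies strictly above some element, which the bottom
    does not.\<close>
  moreover have "n \<noteq> 0"
  proof
    assume "n = 0"
    have "\<forall>i < 28. images ! 0 \<le> images ! i"
      unfolding all_less_28 by (simp add: images_nth)
    then have "q \<le> d" for d
      using n(2) \<open>n = 0\<close> fm3_nth_le_iff[of 0] by (cases d rule: fm3_index) simp
    then show False using q unfolding join_irreducibles_def by (auto dest: leD)
  qed
  moreover have "n \<notin> fst ` set ?xs"
  proof
    assume "n \<in> fst ` set ?xs"
    from *[OF this] show False using q unfolding n(2) by contradiction
  qed
  ultimately have "n \<in> set J_idx" using n(1) by blast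
  then show "q \<in> (!) fm3_list ` set J_idx" using n(2) by (rule rev_image_eqI)
qed

lemma nth_not_meet_irreducible:
  assumes "list_all (\<lambda>(n, i, k). n < 28 \<and> i < 28 \<and> k < 28 \<and> n \<noteq> i \<and> n \<noteq> k \<and> images ! n =
    inf (images ! i) (images ! k)) xs"
    and "n \<in> fst ` set xs"
  shows "fm3_list ! n \<notin> meet_irreducibles"
proof -
  obtain i k where "(n, i, k) \<in> set xs" using assms(2) by fastforce
  then have *: "n < 28" "i < 28" "k < 28" "n \<noteq> i" "n \<noteq> k" "images ! n =
    inf (images ! i) (images ! k)"
    using assms(1) by (auto simp: list_all_iff)
  have "fm3_list ! i \<noteq> fm3_list ! n" "fm3_list ! k \<noteq> fm3_list ! n"
    using * nth_eq_iff_index_eq[OF distinct_fm3_list] length_fm3_list by auto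
  then show ?thesis
    using inf_not_meet_irreducible fm3_nth_inf * by metis
qed

lemma meet_irreducibles_FM3: "(meet_irreducibles :: FM3 set) \<subseteq> (!) fm3_list ` set M_idx"
proof
  fix q :: FM3
  assume q: "q \<in> meet_irreducibles"
  obtain n where n: "n < 28" "q = fm3_list ! n" by (rule fm3_index)
  let ?xs = "[(0,17,1),(1,21,25),(2,17,25),(3,17,21),(4,17,23),(5,21,19),(6,25,19),(7,18,22),(8,12,9),
    (9,13,14),(10,12,14),(11,12,13),(16,17,12),(18,19,12),(20,21,13),(22,23,13),(24,25,14),(26,27,14)] :: (nat \<times> nat \<times> nat) list"
  have "list_all (\<lambda>(n, i, k). n < 28 \<and> i < 28 \<and> k < 28 \<and> n \<noteq> i \<and> n \<noteq> k \<and> images ! n =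
    inf (images ! i) (images ! k)) ?xs"
    by (simp add: images_nth)
  note * = nth_not_meet_irreducible[OF this]
  have "\<forall>n < 28. n \<in> set M_idx \<or> n = 15 \<or> n \<in> fst ` set ?xs"
    unfolding all_less_28 by (simp add: M_idx_def)
  moreover have "n \<noteq> 15"
  proof
    assume "n = 15"
    have "\<forall>i < 28. images ! i \<le> images ! 15"
      unfolding all_less_28 by (simp add: images_nth)
    then have "d \<le> q" for d
      using n(2) \<open>n = 15\<close> fm3_nth_le_iff[of _ 15] by (cases d rule: fm3_index) simp
    then show False using q unfolding meet_irreducibles_def by (auto dest: leD)
  qed
  moreover have "n \<notin> fst ` set ?xs"
  proof
    assume "n \<in> fst ` set ?xs"
    from *[OF this] show False using q unfolding n(2) by contradiction
  qed
  ultimately have "n \<in> set M_idx" using n(1) by blast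
  then show "q \<in> (!) fm3_list ` set M_idx" using n(2) by (rule rev_image_eqI)
qed

section \<open>Additive positions on \<open>FM3\<close>\<close>

text \<open>With explicit index lists and comparisons of tuples, the value at a concrete index
  simplifies to a linear expression in \<open>v\<close> and \<open>w\<close>.\<close>

lemma fm3_additive_value:
  fixes f :: "FM3 \<Rightarrow> real \<times> real"
  assumes "f \<in> standard_AddLD"
  obtains v w where "\<And>i. i < 28 \<Longrightarrow> fst (f (fm3_list ! i)) =
    (\<Sum>j\<leftarrow>J_idx. if images ! j \<le> images ! i then v j else 0) +
    (\<Sum>m\<leftarrow>M_idx. if images ! i \<le> images ! m then 0 else w m)"
proof -
  have fin: "finite (UNIV :: FM3 set)" by (simp add: UNIV_FM3)
  obtain v w where vw: "\<And>x. fst (f x) = (\<Sum>j \<in> (!) fm3_list ` set J_idx. if j \<le> x then v j else 0)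
    + (\<Sum>m \<in> (!) fm3_list ` set M_idx. if x \<le> m then 0 else w m)"
    using standard_AddLD_fst[OF assms fin join_irreducibles_FM3 meet_irreducibles_FM3] by blast
  have idx: "distinct J_idx" "distinct M_idx" "set J_idx \<subseteq> {..<28}" "set M_idx \<subseteq> {..<28}"
    by (auto simp: J_idx_def M_idx_def)
  have inj: "inj_on ((!) fm3_list) (set J_idx)" "inj_on ((!) fm3_list) (set M_idx)"
    using idx by (auto intro!: inj_on_nth distinct_fm3_list simp: length_fm3_list)
  have "fst (f (fm3_list ! i)) =
    (\<Sum>j\<leftarrow>J_idx. if images ! j \<le> images ! i then v (fm3_list ! j) else 0) +
    (\<Sum>m\<leftarrow>M_idx. if images ! i \<le> images ! m then 0 else w (fm3_list ! m))" if "i < 28" for i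
  proof -
    have "(\<Sum>j \<in> set J_idx. if fm3_list ! j \<le> fm3_list ! i then v (fm3_list ! j) else 0) =
      (\<Sum>j \<in> set J_idx. if images ! j \<le> images ! i then v (fm3_list ! j) else 0)"
      "(\<Sum>m \<in> set M_idx. if fm3_list ! i \<le> fm3_list ! m then 0 else w (fm3_list ! m)) =
      (\<Sum>m \<in> set M_idx. if images ! i \<le> images ! m then 0 else w (fm3_list ! m))"
      by (rule sum.cong; use that idx fm3_nth_le_iff in force)+
    then show ?thesis
      unfolding vw sum.reindex[OF inj(1)] sum.reindex[OF inj(2)] comp_def
      by (simp only: sum.distinct_set_conv_list[OF idx(1)] sum.distinct_set_conv_list[OF idx(2)])
  qed
  then show thesis by (rule that)
qed

lemma upt_28: "[0..<28] = [0, Suc 0, 2, 3, 4, 5, 6, 7, 8, 9, 10, 11, 12, 13, 14, 15, 16, 17, 18,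
  19, 20, 21, 22, 23, 24, 25, 26, 27]"
  by code_simp

lemma no_additive_linear_extension:
  fixes f :: "FM3 \<Rightarrow> real \<times> real"
  assumes f: "f \<in> standard_AddLD" and l: "strict_linear_order l" "le_rel - Id \<subseteq> l"
    and pos: "\<And>x. fst (f x) = real (position l x)"
  shows False
proof -
  have fin: "finite (UNIV :: FM3 set)" by (simp add: UNIV_FM3)
  define g where "g i = int (position l (fm3_list ! i))" for i
  have "g ` set [0..<28] = int ` position l ` (!) fm3_list ` {0..<28}"
    by (auto simp: g_def image_iff)
  also have "(!) fm3_list ` {0..<28} = UNIV"
    using nth_image[of "length fm3_list" fm3_list] by (simp add: UNIV_FM3 length_fm3_list)
  also have "int ` range (position l) = {0..27}"
    unfolding range_position[OF fin l(1)] card_FM3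
    using image_int_atLeastLessThan[of 0 28] by (auto simp: lessThan_atLeast0)
  finally have range: "g ` set [0..<28] = {0..27}" .
  have mono: "g i < g k" if "i < 28" "k < 28" "images ! i \<le> images ! k" "i \<noteq> k" for i k
  proof -
    have "(fm3_list ! i, fm3_list ! k) \<in> l"
      using l(2) that fm3_nth_le_iff[of i k] nth_eq_iff_index_eq[OF distinct_fm3_list, of i k]
      by (auto simp: le_rel_def length_fm3_list)
    then show ?thesis using position_less[OF fin l(1)] by (simp add: g_def)
  qed
  \<comment> \<open>Some element has position 0; were it not the bottom, the bottom would have a
    negative position.\<close>
  have "g 0 = 0"
  proof -
    obtain i where i: "i < 28" "g i = 0" using range by (force simp: image_iff set_eq_iff)
    have "\<forall>i < 28. images ! 0 \<le> images ! i"
      unfolding all_less_28 by (simp add: images_nth)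
    then have "i = 0" using mono[of 0 i] i by (auto simp: g_def)
    then show ?thesis using i by simp
  qed
  obtain v w where vw: "\<And>i. i < 28 \<Longrightarrow> fst (f (fm3_list ! i)) =
    (\<Sum>j\<leftarrow>J_idx. if images ! j \<le> images ! i then v j else 0) +
    (\<Sum>m\<leftarrow>M_idx. if images ! i \<le> images ! m then 0 else w m)"
    using fm3_additive_value[OF f] by blast
  have val: "real_of_int (g i) = (\<Sum>j\<leftarrow>J_idx. if images ! j \<le> images ! i then v j else 0) +
    (\<Sum>m\<leftarrow>M_idx. if images ! i \<le> images ! m then 0 else w m)" if "i < 28" for i
    using vw[OF that] pos by (simp add: g_def)
  note val_simps = val J_idx_def M_idx_def images_nth
  \<comment> \<open>Parallel edges of a cube and of the wings attached to it cross the same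
    irreducibles, so they have equal length. The equations follow by expanding in \<open>v\<close>
    and \<open>w\<close>, which are real; hence the cast.\<close>
  have rel: "g 4 = g 2 + g 3"
    "g 5 = g 1 + g 3"
    "g 6 = g 1 + g 2"
    "g 7 = g 1 + g 2 + g 3"
    "g 12 = g 10 + g 11 - g 8"
    "g 13 = g 9 + g 11 - g 8"
    "g 14 = g 9 + g 10 - g 8"
    "g 15 = g 9 + g 10 + g 11 - g 8 - g 8"
    "g 16 = g 2 + g 3 + g 18 - g 7"
    "g 17 = g 2 + g 3 + g 18 - g 7 + g 9 - g 8"
    "g 19 = g 18 + g 9 - g 8"
    "g 20 = g 1 + g 3 + g 22 - g 7"
    "g 21 = g 1 + g 3 + g 22 - g 7 + g 10 - g 8"
    "g 23 = g 22 + g 10 - g 8"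
    "g 24 = g 1 + g 2 + g 26 - g 7"
    "g 25 = g 1 + g 2 + g 26 - g 7 + g 11 - g 8"
    "g 27 = g 26 + g 11 - g 8"
    by (rule of_int_eq_iff[where 'a = real, THEN iffD1];
      simp add: val_simps)+
  \<comment> \<open>Indices 7 and 8 are the bottom and top of the diamond, and 18, 22, 26 are its
    atoms.\<close>
  then have "map g [0..<28] = additive_values (g 1) (g 2) (g 3) (g 18 - g 7) (g 22 - g 7) (g 26 -
    g 7) (g 8 - g 7)
    (g 9 - g 8) (g 10 - g 8) (g 11 - g 8)" (is "_ = ?A")
    using \<open>g 0 = 0\<close> by (simp add: upt_28 additive_values_def cubes_def wing_def Let_def)
  then have vals: "set ?A = {0..27}" using range by (metis list.set_map)
  have "0 < g 1" "0 < g 2" "0 < g 3" "g 8 < g 9" "g 8 < g 10" "g 8 < g 11"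
    "g 7 < g 18" "g 7 < g 22" "g 7 < g 26" "g 18 < g 8" "g 22 < g 8" "g 26 < g 8"
    using mono[of 0 1] mono[of 0 2] mono[of 0 3] mono[of 8 9] mono[of 8 10] mono[of 8 11] \<open>g 0 = 0\<close>
      mono[of 7 18] mono[of 7 22] mono[of 7 26] mono[of 18 8] mono[of 22 8] mono[of 26 8]
    by (simp_all add: images_nth)
  then show False
    by (intro additive_values_not_interval[OF vals]) simp_all
qed

theorem theorem1:
  shows "(reLD :: (FM3 \<Rightarrow> real \<times> real) set) \<inter> standard_AddLD = {}"
proof -
  have False if f: "f \<in> reLD" "f \<in> standard_AddLD" for f :: "FM3 \<Rightarrow> real \<times> real"
  proof -
    obtain l1 l2 T where "f = (\<lambda>c. (real (position l1 c), real (position l2 c)))"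
      and "realizer (le_rel \<union> T) {l1, l2}"
      using f(1) unfolding reLD_def by blast
    \<comment> \<open>A linear extension of the order enlarged by \<open>T\<close> also extends the
      lattice order, so the first coordinate alone gives the contradiction.\<close>
    then show False
      using no_additive_linear_extension[OF f(2), of l1]
      by (auto simp: realizer_def linear_extension_def)
  qed
  then show ?thesis by blast
qed

end
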